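(* Let $M$ be a real symmetric positive-definite $2n\times 2n$ matrix. Then $M$ is orthosymplectically diagonalizable in the sense of Williamson's theorem, i.e. there exists a $2n\times 2n$ real matrix $S$ that is both symplectic and orthogonal such that $S^TMS=\begin{bmatrix} D & 0\\ 0 & D\end{bmatrix}$ with $D$ an $n\times n$ diagonal matrix with positive diagonal entries, if and only if $JM=MJ$.
   Context: $J=J_{2n}=\begin{bmatrix}0_n & I_n\\ -I_n & 0_n\end{bmatrix}$. A real $2n\times 2n$ matrix $S$ is symplectic if $S^TJS=J$ and orthogonal if $S^TS=I_{2n}$. *)

theory Defs
  imports Complex_Main "Jordan_Normal_Form.Matrix"
begin

definition symp_form :: "nat \<Rightarrow> real mat" where
  "symp_form n = four_block_mat (0\<^sub>m n n) (1\<^sub>m n) (- (1\<^sub>m n)) (0\<^sub>m n n)"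

definition symplectic :: "nat \<Rightarrow> real mat \<Rightarrow> bool" where
  "symplectic n S \<longleftrightarrow> S \<in> carrier_mat (2 * n) (2 * n) \<and>
     transpose_mat S * symp_form n * S = symp_form n"

(* The library's orthogonal_mat only asks for pairwise orthogonal nonzero columns,
   without normalization, so it is not the notion needed here. *)
definition orthogonal_matrix :: "nat \<Rightarrow> real mat \<Rightarrow> bool" where
  "orthogonal_matrix k S \<longleftrightarrow> S \<in> carrier_mat k k \<and> transpose_mat S * S = 1\<^sub>m k"

definition sym_pos_def :: "nat \<Rightarrow> real mat \<Rightarrow> bool" where
  "sym_pos_def k M \<longleftrightarrow> M \<in> carrier_mat k k \<and> transpose_mat M = M \<and>
     (\<forall>x \<in> carrier_vec k. x \<noteq> 0\<^sub>v k \<longrightarrow> x \<bullet> (M *\<^sub>v x) > 0)"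

definition pos_diagonal :: "nat \<Rightarrow> real mat \<Rightarrow> bool" where
  "pos_diagonal n D \<longleftrightarrow> D \<in> carrier_mat n n \<and> diagonal_mat D \<and> (\<forall>i<n. D $$ (i, i) > 0)"

definition orthosymplectically_diagonalizable :: "nat \<Rightarrow> real mat \<Rightarrow> bool" where
  "orthosymplectically_diagonalizable n M \<longleftrightarrow>
     (\<exists>S D. symplectic n S \<and> orthogonal_matrix (2 * n) S \<and> pos_diagonal n D \<and>
        transpose_mat S * M * S = four_block_mat D (0\<^sub>m n n) (0\<^sub>m n n) D)"

end

theory Submission
  imports Defs "Jordan_Normal_Form.Schur_Decomposition"
begin

text \<open>
  The map \<open>X + \<i>Y \<mapsto> [[X, Y], [-Y, X]]\<close> is an injective *-homomorphism from complex to real matrices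
  that sends \<open>\<i>\<close> to \<open>J\<close>, and its image is the centralizer of \<open>J\<close>. A symmetric matrix commuting with
  \<open>J\<close> is therefore the image of a Hermitian matrix \<open>H\<close>. A unitary \<open>U\<close> diagonalizing \<open>H\<close> is mapped to
  an orthosymplectic matrix, and the real diagonal matrix \<open>U\<^sup>*HU\<close> to two copies of itself.
  Conversely, an orthosymplectic matrix commutes with \<open>J\<close>, and so does \<open>diag(D, D)\<close>.
\<close>

section \<open>Adjoints of complex matrices\<close>

text \<open>Trades the definition of \<open>mat_adjoint\<close> by a list of rows for a form whose
  entries and dimensions simplify directly.\<close>

lemma mat_adjoint_conv: "mat_adjoint A = map_mat conjugate (transpose_mat A)"
  by (rule eq_matI) (auto simp: mat_adjoint_def mat_of_rows_index)

lemma mat_adjoint_carrier: "A \<in> carrier_mat n m \<Longrightarrow> mat_adjoint A \<in> carrier_mat m n"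
  by (auto simp: mat_adjoint_conv)

lemma mat_adjoint_dim [simp]:
  "dim_row (mat_adjoint A) = dim_col A" "dim_col (mat_adjoint A) = dim_row A"
  by (simp_all add: mat_adjoint_conv)

lemma mat_adjoint_index:
  "i < dim_col A \<Longrightarrow> j < dim_row A \<Longrightarrow> mat_adjoint A $$ (i, j) = conjugate (A $$ (j, i))"
  by (simp add: mat_adjoint_conv)

lemma mat_adjoint_mult:
  fixes A B :: "complex mat"
  assumes "A \<in> carrier_mat n k" and "B \<in> carrier_mat k m"
  shows "mat_adjoint (A * B) = mat_adjoint B * mat_adjoint A"
  by (rule eq_matI) (use assms in \<open>auto simp: mat_adjoint_conv scalar_prod_def mult.commute\<close>)

lemma mat_adjoint_mat_adjoint [simp]:
  fixes A :: "complex mat"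
  shows "mat_adjoint (mat_adjoint A) = A"
  by (rule eq_matI) (auto simp: mat_adjoint_conv)

lemma mat_adjoint_congruence:
  fixes A U :: "complex mat"
  assumes A: "A \<in> carrier_mat n n" and U: "U \<in> carrier_mat n m" and "mat_adjoint A = A"
  shows "mat_adjoint (mat_adjoint U * A * U) = mat_adjoint U * A * U"
proof -
  have "mat_adjoint (mat_adjoint U * A * U) = mat_adjoint U * (mat_adjoint A * U)"
    using mat_adjoint_mult[OF mult_carrier_mat[OF mat_adjoint_carrier[OF U] A] U]
      mat_adjoint_mult[OF mat_adjoint_carrier[OF U] A] by simp
  also have "\<dots> = mat_adjoint U * A * U"
    using assoc_mult_mat[OF mat_adjoint_carrier[OF U] A U] assms(3) by simp
  finally show ?thesis .
qed

section \<open>The spectral theorem for Hermitian matrices\<close>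

text \<open>Gram-Schmidt applied to a basis that begins with \<open>v\<close> leaves its first
  vector unchanged. Normalizing the resulting orthogonal vectors gives the columns of
  \<open>W\<close>, so the first column is only rescaled.\<close>

lemma unitary_completion:
  fixes v :: "complex vec"
  assumes v: "v \<in> carrier_vec n" and v0: "v \<noteq> 0\<^sub>v n"
  obtains W c where "W \<in> carrier_mat n n" "mat_adjoint W * W = 1\<^sub>m n" "col W 0 = c \<cdot>\<^sub>v v"
proof -
  interpret cof_vec_space n "TYPE(complex)" .
  define b where "b = basis_completion v"
  define ws where "ws = gram_schmidt n b"
  note bc = basis_completion[OF v v0, folded b_def]
  have n: "n > 0" using v v0 by (cases n) auto
  obtain vs where b: "b = v # vs" using bc n by (cases b) auto
  from gram_schmidt_result[OF bc(2) bc(4) bc(5) refl, folded ws_def]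
  have ws: "set ws \<subseteq> carrier_vec n" "corthogonal ws" "length ws = n"
    by (auto simp: bc)
  from gram_schmidt_hd[OF v, of vs, folded b] have "hd ws = v" unfolding ws_def .
  then have ws0: "ws ! 0 = v" using n ws by (cases ws) auto
  have wsc: "ws ! j \<in> carrier_vec n" if "j < n" for j using ws that by auto
  \<comment> \<open>\<open>c j\<close> is the norm of \<open>ws ! j\<close>, embedded in the complex
    numbers. \<open>Re\<close> loses nothing, since the inner product of a vector with itself is
    real and nonnegative.\<close>
  define c where "c j = complex_of_real (sqrt (Re (ws ! j \<bullet>c ws ! j)))" for j
  have cc: "c j * c j = ws ! j \<bullet>c ws ! j" "c j \<noteq> 0" if "j < n" for j
  proof -
    have "ws ! j \<bullet>c ws ! j \<ge> 0" by (rule conjugate_square_ge_0_vec)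
    moreover have "ws ! j \<bullet>c ws ! j \<noteq> 0" using corthogonalD[OF ws(2)] that ws(3) by simp
    ultimately show "c j * c j = ws ! j \<bullet>c ws ! j" "c j \<noteq> 0"
      by (auto simp: c_def complex_eq_iff less_eq_complex_def)
  qed
  define W where "W = mat n n (\<lambda>(i, j). ws ! j $ i / c j)"
  have W: "W \<in> carrier_mat n n" by (simp add: W_def)
  moreover have "mat_adjoint W * W = 1\<^sub>m n"
  proof (rule eq_matI)
    fix i j assume "i < dim_row (1\<^sub>m n :: complex mat)" "j < dim_col (1\<^sub>m n :: complex mat)"
    then have ij: "i < n" "j < n" by auto
    have "(mat_adjoint W * W) $$ (i, j) = (\<Sum>k = 0..<n. cnj (ws ! i $ k / c i) * (ws ! j $ k / c j))"
      using W ij by (simp add: scalar_prod_def mat_adjoint_conv W_def)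
    \<comment> \<open>The conjugation leaves \<open>c i\<close> alone because it is real.\<close>
    also have "\<dots> = (ws ! j \<bullet>c ws ! i) / (c i * c j)"
      using wsc[OF ij(1)] wsc[OF ij(2)]
      by (simp add: scalar_prod_def sum_divide_distrib c_def mult.commute)
    also have "\<dots> = 1\<^sub>m n $$ (i, j)"
      using ij corthogonalD[OF ws(2), of j i] ws(3) cc[OF ij(1)] by (auto simp: mult.commute)
    finally show "(mat_adjoint W * W) $$ (i, j) = 1\<^sub>m n $$ (i, j)" .
  qed (use W in auto)
  moreover have "col W 0 = (1 / c 0) \<cdot>\<^sub>v v"
    by (rule eq_vecI) (use v n in \<open>auto simp: W_def ws0\<close>)
  ultimately show thesis using that by blast
qed

lemma mult_diag_blocks:
  fixes A A' B B' :: "'a :: comm_ring_1 mat"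
  assumes "A \<in> carrier_mat n n" "A' \<in> carrier_mat n n" "B \<in> carrier_mat m m" "B' \<in> carrier_mat m m"
  shows "four_block_mat A (0\<^sub>m n m) (0\<^sub>m m n) B * four_block_mat A' (0\<^sub>m n m) (0\<^sub>m m n) B' =
    four_block_mat (A * A') (0\<^sub>m n m) (0\<^sub>m m n) (B * B')"
  using assms by (subst mult_four_block_mat[where ?nr1.0 = n and ?n1.0 = n and ?n2.0 = m
        and ?nr2.0 = m and ?nc1.0 = n and ?nc2.0 = m]) auto

text \<open>Deflation by induction on the dimension: conjugating by a unitary matrix whose first
  column is an eigenvector splits off the eigenvalue and leaves a smaller Hermitian block. Taking
  \<open>D\<close> as a real matrix records that the eigenvalues are real.\<close>

lemma hermitian_spectral:
  fixes A :: "complex mat"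
  assumes "A \<in> carrier_mat n n" and "mat_adjoint A = A"
  shows "\<exists>U D. U \<in> carrier_mat n n \<and> mat_adjoint U * U = 1\<^sub>m n \<and> D \<in> carrier_mat n n \<and>
    diagonal_mat D \<and> mat_adjoint U * A * U = map_mat complex_of_real D"
  using assms
proof (induction n arbitrary: A)
  case 0
  then show ?case
    by (intro exI[of _ "1\<^sub>m 0"] exI[of _ "1\<^sub>m 0"]) (auto simp: diagonal_mat_def intro!: eq_matI)
next
  case (Suc n A)
  let ?n = "Suc n"
  note A = Suc.prems(1)
  \<comment> \<open>The characteristic polynomial splits over the complex numbers, and its list of
    \<open>?n\<close> roots is nonempty, so an eigenvalue exists.\<close>
  obtain as where as: "char_poly A = (\<Prod>a\<leftarrow>as. [:- a, 1:])" "length as = ?n"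
    using char_poly_factorized[OF A] by blast
  then obtain e where "e \<in> set as" by (cases as) auto
  then have "poly (char_poly A) e = 0"
    by (auto simp: as poly_prod_list prod_list_zero_iff)
  then have "eigenvalue A e" using eigenvalue_root_char_poly[OF A] by simp
  then obtain v where v: "v \<in> carrier_vec ?n" "v \<noteq> 0\<^sub>v ?n" "A *\<^sub>v v = e \<cdot>\<^sub>v v"
    using A unfolding eigenvalue_def eigenvector_def by auto
  obtain W c where W: "W \<in> carrier_mat ?n ?n" "mat_adjoint W * W = 1\<^sub>m ?n" "col W 0 = c \<cdot>\<^sub>v v"
    using unitary_completion[OF v(1,2)] .
  have W': "mat_adjoint W \<in> carrier_mat ?n ?n" using W by (simp add: mat_adjoint_carrier)
  define B where "B = mat_adjoint W * A * W"
  have B: "B \<in> carrier_mat ?n ?n" using W' W A by (simp add: B_def)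
  have B_herm: "mat_adjoint B = B"
    unfolding B_def by (rule mat_adjoint_congruence[OF A W(1) Suc.prems(2)])
  have B_sym: "B $$ (i, j) = cnj (B $$ (j, i))" if "i < ?n" "j < ?n" for i j
    using mat_adjoint_index[of i B j] that B B_herm by simp
  \<comment> \<open>Since \<open>col W 0\<close> is an eigenvector, column 0 of \<open>B\<close> is
    \<open>e\<close> times column 0 of \<open>mat_adjoint W * W\<close>, which is the
    identity.\<close>
  have B_col: "B $$ (i, 0) = (if i = 0 then e else 0)" if "i < ?n" for i
  proof -
    have "col (A * W) 0 = A *\<^sub>v col W 0" using A W by (subst col_mult2[of _ ?n ?n _ ?n]) auto
    also have "\<dots> = e \<cdot>\<^sub>v col W 0"
      using A v by (simp add: W(3) mult_mat_vec smult_smult_assoc mult.commute)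
    finally have "col (A * W) 0 = e \<cdot>\<^sub>v col W 0" .
    moreover have "B $$ (i, 0) = row (mat_adjoint W) i \<bullet> col (A * W) 0"
      using A W W' that unfolding B_def assoc_mult_mat[OF W' A W(1)] by simp
    moreover have "row (mat_adjoint W) i \<in> carrier_vec ?n" "col W 0 \<in> carrier_vec ?n"
      by (rule carrier_vecI, use W(1) in simp)+
    then have "row (mat_adjoint W) i \<bullet> (e \<cdot>\<^sub>v col W 0) = e * (row (mat_adjoint W) i \<bullet> col W 0)"
      by (rule scalar_prod_smult_distrib)
    moreover have "(mat_adjoint W * W) $$ (i, 0) = row (mat_adjoint W) i \<bullet> col W 0"
      using W(1) W' that by simp
    ultimately have "B $$ (i, 0) = e * (mat_adjoint W * W) $$ (i, 0)" by metis
    then show ?thesis using that by (simp add: W(2))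
  qed
  define B3 where "B3 = mat n n (\<lambda>(i, j). B $$ (Suc i, Suc j))"
  have B3: "B3 \<in> carrier_mat n n" by (simp add: B3_def)
  \<comment> \<open>\<open>e\<close> is a diagonal entry of the Hermitian matrix \<open>B\<close>,
    hence real.\<close>
  have e: "cnj e = e" using B_sym[of 0 0] B_col[of 0] by simp
  then obtain r where r: "e = complex_of_real r"
    by (metis Reals_cnj_iff Reals_cases)
  \<comment> \<open>Column 0 vanishes below the corner, and Hermitian symmetry carries these zeros
    over to row 0.\<close>
  have B_block: "B = four_block_mat (mat 1 1 (\<lambda>_. e)) (0\<^sub>m 1 n) (0\<^sub>m n 1) B3"
  proof (rule eq_matI)
    fix i j
    assume "i < dim_row (four_block_mat (mat 1 1 (\<lambda>_. e)) (0\<^sub>m 1 n) (0\<^sub>m n 1) B3)"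
      and "j < dim_col (four_block_mat (mat 1 1 (\<lambda>_. e)) (0\<^sub>m 1 n) (0\<^sub>m n 1) B3)"
    then have "i < ?n" "j < ?n" by (auto simp: B3_def)
    then show "B $$ (i, j) = four_block_mat (mat 1 1 (\<lambda>_. e)) (0\<^sub>m 1 n) (0\<^sub>m n 1) B3 $$ (i, j)"
      using B_col[of i] B_sym[of 0 j] B_col[of j] by (auto simp: B3_def)
  qed (use B in \<open>auto simp: B3_def\<close>)
  have "mat_adjoint B3 = B3"
    by (rule eq_matI) (simp_all add: B3_def mat_adjoint_conv flip: B_sym)
  from Suc.IH[OF B3 this] obtain U3 D3 where
    U3: "U3 \<in> carrier_mat n n" "mat_adjoint U3 * U3 = 1\<^sub>m n" and
    D3: "D3 \<in> carrier_mat n n" "diagonal_mat D3"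
      "mat_adjoint U3 * B3 * U3 = map_mat complex_of_real D3"
    by blast
  have U3': "mat_adjoint U3 \<in> carrier_mat n n" using U3 by (simp add: mat_adjoint_carrier)
  \<comment> \<open>\<open>V\<close> fixes the first coordinate, so conjugating by it keeps the
    corner \<open>e\<close> and diagonalizes \<open>B3\<close>. The unitary matrix for
    \<open>A\<close> will be \<open>W * V\<close>.\<close>
  define V where "V = four_block_mat (1\<^sub>m 1) (0\<^sub>m 1 n) (0\<^sub>m n 1) U3"
  define D where "D = four_block_mat (mat 1 1 (\<lambda>_. r)) (0\<^sub>m 1 n) (0\<^sub>m n 1) D3"
  have V: "V \<in> carrier_mat ?n ?n" using U3 by (auto simp: V_def)
  have V_adj: "mat_adjoint V = four_block_mat (1\<^sub>m 1) (0\<^sub>m 1 n) (0\<^sub>m n 1) (mat_adjoint U3)"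
    by (rule eq_matI) (use U3 in \<open>auto simp: V_def mat_adjoint_conv\<close>)
  have V': "mat_adjoint V \<in> carrier_mat ?n ?n" using V by (simp add: mat_adjoint_carrier)
  have VV: "mat_adjoint V * V = 1\<^sub>m ?n"
    unfolding V_adj unfolding V_def mult_diag_blocks[OF one_carrier_mat one_carrier_mat U3' U3(1)]
    by (simp add: U3(2))
  have e1: "mat 1 1 (\<lambda>_. e) \<in> carrier_mat 1 1" by simp
  have VBV: "mat_adjoint V * B * V = map_mat complex_of_real D"
    unfolding V_adj B_block unfolding V_def
      mult_diag_blocks[OF one_carrier_mat e1 U3' B3]
      mult_diag_blocks[OF mult_carrier_mat[OF one_carrier_mat e1] one_carrier_mat
        mult_carrier_mat[OF U3' B3] U3(1)] D3(3)
    by (rule eq_matI) (use D3(1) in \<open>auto simp: D_def r\<close>)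
  have UU: "mat_adjoint (W * V) = mat_adjoint V * mat_adjoint W"
    by (rule mat_adjoint_mult[OF W(1) V])
  have "mat_adjoint (W * V) * (W * V) = mat_adjoint V * (mat_adjoint W * W) * V"
    unfolding UU using W(1) W' V V'
    by (simp add: assoc_mult_mat[where ?n\<^sub>1 = ?n and ?n\<^sub>2 = ?n and ?n\<^sub>3 = ?n and ?n\<^sub>4 = ?n])
  also have "\<dots> = 1\<^sub>m ?n" by (simp only: W(2) right_mult_one_mat[OF V'] VV)
  finally have 1: "mat_adjoint (W * V) * (W * V) = 1\<^sub>m ?n" .
  have "mat_adjoint (W * V) * A * (W * V) = mat_adjoint V * B * V"
    unfolding UU B_def using W(1) W' V V' A
    by (simp add: assoc_mult_mat[where ?n\<^sub>1 = ?n and ?n\<^sub>2 = ?n and ?n\<^sub>3 = ?n and ?n\<^sub>4 = ?n])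
  then have 2: "mat_adjoint (W * V) * A * (W * V) = map_mat complex_of_real D"
    by (simp add: VBV)
  have D: "D \<in> carrier_mat ?n ?n" "diagonal_mat D"
    using D3 by (auto simp: D_def diagonal_mat_def)
  show ?case
    using 1 2 D W(1) V by (intro exI[of _ "W * V"] exI[of _ D]) auto
qed

section \<open>Complex matrices as real matrices of twice the size\<close>

definition realify :: "complex mat \<Rightarrow> real mat" where
  "realify A = four_block_mat (map_mat Re A) (map_mat Im A) (- map_mat Im A) (map_mat Re A)"

lemma realify_carrier:
  "A \<in> carrier_mat n n \<Longrightarrow> realify A \<in> carrier_mat (2 * n) (2 * n)"
  by (auto simp: realify_def)

lemma realify_mult:
  assumes A: "A \<in> carrier_mat n n" and B: "B \<in> carrier_mat n n"
  shows "realify (A * B) = realify A * realify B"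
proof -
  have "map_mat Re (A * B) = map_mat Re A * map_mat Re B + map_mat Im A * (- map_mat Im B)"
    by (rule eq_matI) (use A B in \<open>auto simp: scalar_prod_def sum_subtractf sum_negf\<close>)
  moreover have "map_mat Im (A * B) = map_mat Re A * map_mat Im B + map_mat Im A * map_mat Re B"
    by (rule eq_matI) (use A B in \<open>auto simp: scalar_prod_def sum.distrib\<close>)
  \<comment> \<open>This identity and the next match the lower block row of the product, where the
    same imaginary and real parts appear with signs and summands arranged differently.\<close>
  moreover have "- (map_mat Re A * map_mat Im B + map_mat Im A * map_mat Re B) =
      (- map_mat Im A) * map_mat Re B + map_mat Re A * (- map_mat Im B)"
    by (rule eq_matI) (use A B in \<open>auto simp: scalar_prod_def sum_negf\<close>)
  moreover have "map_mat Re A * map_mat Re B + map_mat Im A * (- map_mat Im B) =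
      (- map_mat Im A) * map_mat Im B + map_mat Re A * map_mat Re B"
    by (rule eq_matI) (use A B in \<open>auto simp: scalar_prod_def sum_negf\<close>)
  ultimately show ?thesis
    unfolding realify_def using A B
    by (subst mult_four_block_mat[where ?nr1.0 = n and ?n1.0 = n and ?n2.0 = n
          and ?nr2.0 = n and ?nc1.0 = n and ?nc2.0 = n]) auto
qed

lemma realify_adjoint: "A \<in> carrier_mat n n \<Longrightarrow> realify (mat_adjoint A) = transpose_mat (realify A)"
  by (rule eq_matI) (auto simp: realify_def mat_adjoint_conv)

lemma realify_one: "realify (1\<^sub>m n) = 1\<^sub>m (2 * n)"
  by (rule eq_matI) (auto simp: realify_def)

lemma realify_ii: "realify (\<i> \<cdot>\<^sub>m 1\<^sub>m n) = symp_form n"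
  by (rule eq_matI) (auto simp: realify_def symp_form_def)

lemma realify_of_real:
  "D \<in> carrier_mat n n \<Longrightarrow>
    realify (map_mat complex_of_real D) = four_block_mat D (0\<^sub>m n n) (0\<^sub>m n n) D"
  by (rule eq_matI) (auto simp: realify_def)

lemma realify_inject:
  assumes "A \<in> carrier_mat n n" "B \<in> carrier_mat n n" "realify A = realify B"
  shows "A = B"
proof (rule eq_matI)
  fix i j assume "i < dim_row B" "j < dim_col B"
  \<comment> \<open>The upper block row suffices: its two blocks hold the real and the imaginary
    parts.\<close>
  with arg_cong[OF assms(3), of "\<lambda>M. M $$ (i, j)"]
    arg_cong[OF assms(3), of "\<lambda>M. M $$ (i, j + n)"] assms(1,2)
  show "A $$ (i, j) = B $$ (i, j)" by (auto simp: realify_def complex_eq_iff)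
qed (use assms in auto)

lemma symp_form_carrier: "symp_form n \<in> carrier_mat (2 * n) (2 * n)"
  by (auto simp: symp_form_def)

text \<open>Multiplying by \<open>symp_form n\<close> on the left permutes the block rows of
  \<open>M\<close>, and on the right its block columns, up to signs. Equating the results forces the
  block pattern of \<open>realify\<close>.\<close>

lemma commute_symp_form_imp_realify:
  assumes M: "M \<in> carrier_mat (2 * n) (2 * n)" and comm: "symp_form n * M = M * symp_form n"
  obtains H where "H \<in> carrier_mat n n" "M = realify H"
proof -
  define A B C D where "A = mat n n (\<lambda>(i, j). M $$ (i, j))"
    and "B = mat n n (\<lambda>(i, j). M $$ (i, j + n))"
    and "C = mat n n (\<lambda>(i, j). M $$ (i + n, j))"
    and "D = mat n n (\<lambda>(i, j). M $$ (i + n, j + n))"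
  note blocks = A_def B_def C_def D_def
  have M_block: "M = four_block_mat A B C D"
    by (rule eq_matI) (use M in \<open>auto simp: blocks\<close>)
  have c: "A \<in> carrier_mat n n" "B \<in> carrier_mat n n" "C \<in> carrier_mat n n" "D \<in> carrier_mat n n"
    by (auto simp: blocks)
  have "symp_form n * M = four_block_mat C D (- A) (- B)"
    unfolding symp_form_def M_block using c
    by (subst mult_four_block_mat[where ?nr1.0 = n and ?n1.0 = n and ?n2.0 = n
          and ?nr2.0 = n and ?nc1.0 = n and ?nc2.0 = n]) auto
  moreover have "M * symp_form n = four_block_mat (- B) A (- D) C"
    unfolding symp_form_def M_block using c
    by (subst mult_four_block_mat[where ?nr1.0 = n and ?n1.0 = n and ?n2.0 = n
          and ?nr2.0 = n and ?nc1.0 = n and ?nc2.0 = n]) auto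
  ultimately have eq: "four_block_mat C D (- A) (- B) = four_block_mat (- B) A (- D) C"
    using comm by simp
  \<comment> \<open>Comparing upper block rows already gives both relations.\<close>
  have "C $$ (i, j) = - B $$ (i, j)" "D $$ (i, j) = A $$ (i, j)" if "i < n" "j < n" for i j
    using arg_cong[OF eq, of "\<lambda>M. M $$ (i, j)"] arg_cong[OF eq, of "\<lambda>M. M $$ (i, j + n)"] that c
    by auto
  then have "C = - B" "D = A"
    using c by (auto intro!: eq_matI)
  define H where "H = mat n n (\<lambda>(i, j). Complex (A $$ (i, j)) (B $$ (i, j)))"
  have "map_mat Re H = A" "map_mat Im H = B"
    using c by (auto simp: H_def intro!: eq_matI)
  then have "M = realify H"
    using M_block \<open>C = - B\<close> \<open>D = A\<close> by (simp add: realify_def)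
  then show thesis using that[of H] by (simp add: H_def)
qed

section \<open>The two implications\<close>

text \<open>Multiply the symplectic identity by \<open>S\<close> on the left; orthogonality cancels
  \<open>S * transpose_mat S\<close>.\<close>

lemma orthosymplectic_commute:
  assumes "symplectic n S" and "orthogonal_matrix (2 * n) S"
  shows "symp_form n * S = S * symp_form n"
proof -
  let ?J = "symp_form n"
  have S: "S \<in> carrier_mat (2 * n) (2 * n)" and symp: "transpose_mat S * ?J * S = ?J"
    and orth: "transpose_mat S * S = 1\<^sub>m (2 * n)"
    using assms by (auto simp: symplectic_def orthogonal_matrix_def)
  have S': "transpose_mat S \<in> carrier_mat (2 * n) (2 * n)" using S by simp
  have SS': "S * transpose_mat S = 1\<^sub>m (2 * n)" by (rule mat_mult_left_right_inverse[OF S' S orth])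
  have "S * ?J = S * transpose_mat S * ?J * S"
    by (subst symp[symmetric]) (use S S' symp_form_carrier in \<open>simp add:
      assoc_mult_mat[where ?n\<^sub>1 = "2 * n" and ?n\<^sub>2 = "2 * n" and ?n\<^sub>3 = "2 * n" and ?n\<^sub>4 = "2 * n"]\<close>)
  then show ?thesis using S symp_form_carrier by (simp add: SS' left_mult_one_mat[where nr = "2 * n" and nc = "2 * n"])
qed

text \<open>Undoing the diagonalization writes \<open>M\<close> as \<open>S * E * T\<close> with
  \<open>T\<close> the transpose of \<open>S\<close>. The form \<open>?J\<close> commutes with each
  factor and so moves through the product.\<close>

lemma orthosymplectically_diagonalizable_imp_commute:
  assumes M: "M \<in> carrier_mat (2 * n) (2 * n)" and "orthosymplectically_diagonalizable n M"
  shows "symp_form n * M = M * symp_form n"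
proof -
  let ?J = "symp_form n" and ?c = "carrier_mat (2 * n) (2 * n)"
  obtain S D where symp: "symplectic n S" and orth: "orthogonal_matrix (2 * n) S"
    and D: "pos_diagonal n D"
    and diag: "transpose_mat S * M * S = four_block_mat D (0\<^sub>m n n) (0\<^sub>m n n) D"
    using assms unfolding orthosymplectically_diagonalizable_def by blast
  define E where "E = four_block_mat D (0\<^sub>m n n) (0\<^sub>m n n) D"
  define T where "T = transpose_mat S"
  note assoc = assoc_mult_mat[where ?n\<^sub>1 = "2 * n" and ?n\<^sub>2 = "2 * n" and ?n\<^sub>3 = "2 * n" and ?n\<^sub>4 = "2 * n"]
  have S: "S \<in> ?c" and TS: "T * S = 1\<^sub>m (2 * n)"
    using orth by (auto simp: orthogonal_matrix_def T_def)
  have T: "T \<in> ?c" using S by (simp add: T_def)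
  have D': "D \<in> carrier_mat n n" using D by (simp add: pos_diagonal_def)
  have E: "E \<in> ?c" using D' by (auto simp: E_def)
  have J: "?J \<in> ?c" by (rule symp_form_carrier)
  have ST: "S * T = 1\<^sub>m (2 * n)" by (rule mat_mult_left_right_inverse[OF T S TS])
  have JS: "?J * S = S * ?J" by (rule orthosymplectic_commute[OF symp orth])
  \<comment> \<open>Insert \<open>S * T = 1\<close> on the right, exchange \<open>?J\<close> and
    \<open>S\<close>, then cancel \<open>T * S\<close>.\<close>
  have "T * ?J = T * (?J * S) * T"
    using S T J by (simp add: assoc ST)
  also have "\<dots> = ?J * T"
    unfolding JS using S T J by (simp add: assoc TS flip: assoc[OF T S])
  finally have TJ: "T * ?J = ?J * T" .
  \<comment> \<open>Pulled back along \<open>realify\<close>, \<open>?J\<close> becomes the scalar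
    matrix of \<open>\<i>\<close>, which commutes with every matrix of its size.\<close>
  have E_real: "E = realify (map_mat complex_of_real D)"
    using D' by (simp add: E_def realify_of_real)
  have D_com: "(\<i> \<cdot>\<^sub>m 1\<^sub>m n) * map_mat complex_of_real D = map_mat complex_of_real D * (\<i> \<cdot>\<^sub>m 1\<^sub>m n)"
    using D' by (simp add: mult_smult_assoc_mat[where nr = n and n = n and nc = n]
        mult_smult_distrib[where nr = n and n = n and nc = n] left_mult_one_mat[where nr = n]
        right_mult_one_mat[where nc = n])
  have "?J * E = realify ((\<i> \<cdot>\<^sub>m 1\<^sub>m n) * map_mat complex_of_real D)"
    using D' by (simp add: E_real realify_mult[where n = n] realify_ii)
  also have "\<dots> = E * ?J"
    unfolding D_com using D' by (simp add: E_real realify_mult[where n = n] realify_ii)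
  finally have JE: "?J * E = E * ?J" .
  have "S * (T * M * S) * T = S * T * M * (S * T)"
    using S T M by (simp add: assoc)
  then have M_eq: "M = S * E * T"
    using M by (simp add: ST E_def diag[folded T_def])
  have "?J * M = (?J * S) * E * T" using S T E J by (simp add: M_eq assoc)
  also have "\<dots> = S * (?J * E) * T" unfolding JS using S T E J by (simp add: assoc)
  also have "\<dots> = S * E * (?J * T)" unfolding JE using S T E J by (simp add: assoc)
  also have "\<dots> = M * ?J" unfolding TJ[symmetric] using S T E J by (simp add: M_eq assoc)
  finally show ?thesis .
qed

text \<open>Under \<open>realify\<close>, unitarity of \<open>U\<close> yields both orthogonality
  and symplecticity of \<open>S\<close>. Positive definiteness, tested on columns of
  \<open>S\<close>, makes the entries of \<open>D\<close> positive.\<close>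

lemma commute_imp_orthosymplectically_diagonalizable:
  assumes pd: "sym_pos_def (2 * n) M" and comm: "symp_form n * M = M * symp_form n"
  shows "orthosymplectically_diagonalizable n M"
proof -
  have M: "M \<in> carrier_mat (2 * n) (2 * n)" "transpose_mat M = M"
    using pd by (auto simp: sym_pos_def_def)
  obtain H where H: "H \<in> carrier_mat n n" "M = realify H"
    using commute_symp_form_imp_realify[OF M(1) comm] .
  \<comment> \<open>Symmetry of \<open>M\<close> transfers to \<open>H\<close> because
    \<open>realify\<close> is injective and turns adjoints into transposes.\<close>
  have "mat_adjoint H = H"
    using H M(2) by (intro realify_inject[where n = n]) (auto simp: realify_adjoint[where n = n] mat_adjoint_carrier)
  from hermitian_spectral[OF H(1) this] obtain U D where
    U: "U \<in> carrier_mat n n" "mat_adjoint U * U = 1\<^sub>m n" and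
    D: "D \<in> carrier_mat n n" "diagonal_mat D" "mat_adjoint U * H * U = map_mat complex_of_real D"
    by blast
  have U': "mat_adjoint U \<in> carrier_mat n n" using U by (simp add: mat_adjoint_carrier)
  define S where "S = realify U"
  have S: "S \<in> carrier_mat (2 * n) (2 * n)" using U by (simp add: S_def realify_carrier)
  have S': "transpose_mat S = realify (mat_adjoint U)"
    using U by (simp add: S_def realify_adjoint)
  have orth: "transpose_mat S * S = 1\<^sub>m (2 * n)"
    unfolding S' unfolding S_def by (simp add: realify_one U(2) flip: realify_mult[OF U' U(1)])
  have "transpose_mat S * symp_form n * S = realify (mat_adjoint U * (\<i> \<cdot>\<^sub>m 1\<^sub>m n) * U)"
    unfolding S' unfolding S_def using U(1) U' by (simp add: realify_mult[where n = n] realify_ii)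
  \<comment> \<open>The scalar \<open>\<i>\<close> passes through the product, leaving
    \<open>mat_adjoint U * U\<close>.\<close>
  also have "mat_adjoint U * (\<i> \<cdot>\<^sub>m 1\<^sub>m n) * U = \<i> \<cdot>\<^sub>m 1\<^sub>m n"
    using U U' by (simp add: mult_smult_assoc_mat[where nr = n and n = n and nc = n]
        mult_smult_distrib[where nr = n and n = n and nc = n] right_mult_one_mat[where nc = n])
  finally have symp: "transpose_mat S * symp_form n * S = symp_form n"
    by (simp add: realify_ii)
  have "transpose_mat S * M * S = realify (mat_adjoint U * H * U)"
    unfolding S' unfolding S_def H(2) using U(1) U' H(1)
    by (simp only: realify_mult[OF mult_carrier_mat[OF U' H(1)] U(1)] realify_mult[OF U' H(1)])
  then have diag: "transpose_mat S * M * S = four_block_mat D (0\<^sub>m n n) (0\<^sub>m n n) D"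
    using D by (simp add: realify_of_real)
  \<comment> \<open>The entry is the quadratic form of \<open>M\<close> at column \<open>i\<close>
    of \<open>S\<close>, a unit vector and hence nonzero. Indices below \<open>n\<close> select the
    upper left copy of \<open>D\<close>.\<close>
  have "D $$ (i, i) > 0" if i: "i < n" for i
  proof -
    let ?x = "col S i"
    have x: "?x \<in> carrier_vec (2 * n)" by (rule carrier_vecI) (use S in simp)
    have "?x \<bullet> ?x = (transpose_mat S * S) $$ (i, i)" using S i by simp
    also have "\<dots> = 1" unfolding orth using i by simp
    finally have "?x \<noteq> 0\<^sub>v (2 * n)" by auto
    then have "?x \<bullet> (M *\<^sub>v ?x) > 0" using pd x by (auto simp: sym_pos_def_def)
    also have "?x \<bullet> (M *\<^sub>v ?x) = (transpose_mat S * (M * S)) $$ (i, i)"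
      using S M i col_mult2[OF M(1) S, of i] by simp
    also have "transpose_mat S * (M * S) = transpose_mat S * M * S"
      by (rule assoc_mult_mat[symmetric, OF _ M(1) S]) (use S in simp)
    also have "(transpose_mat S * M * S) $$ (i, i) = D $$ (i, i)"
      unfolding diag using D i by simp
    finally show ?thesis .
  qed
  then show ?thesis
    unfolding orthosymplectically_diagonalizable_def symplectic_def orthogonal_matrix_def pos_diagonal_def
    using S orth symp diag D(1,2) by blast
qed

theorem corollary3p6:
  fixes n :: nat and M :: "real mat"
  assumes "sym_pos_def (2 * n) M"
  shows "orthosymplectically_diagonalizable n M \<longleftrightarrow> symp_form n * M = M * symp_form n"
  using assms orthosymplectically_diagonalizable_imp_commute
    commute_imp_orthosymplectically_diagonalizable
  unfolding sym_pos_def_def by blast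

end
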